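(* Let $q=4$ and $n=1+2q^1+2q^{e-1}+2q^{e+1}$, where $e>1$ is an integer. Then $$g_{n,q}\equiv S_2+X^2S_e^2+S_{e-1}^2S_e^2\pmod{X^{q^e}-X}.$$ If $e$ is odd, then $g_{n,q}$ is a permutation polynomial of $\mathbb F_{q^e}$.
   Context: For a prime power $q$ with $p=\operatorname{char}\mathbb F_q$ and an integer $n\ge 0$, $g_{n,q}\in\mathbb F_p[X]$ is the polynomial defined by the functional equation $\sum_{c\in\mathbb F_q}(X+c)^n=g_{n,q}(X^q-X)$. For each integer $a\ge 0$, $S_a=X+X^q+\cdots+X^{q^{a-1}}$ (with $S_0=0$). Products and powers of the $S_a$ are ordinary products and powers of polynomials. A polynomial over a finite field $F$ is a permutation polynomial of $F$ if it induces a bijection $F\to F$. *)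

theory Defs
  imports
    "HOL-Computational_Algebra.Computational_Algebra"
    "HOL-Number_Theory.Cong"
    "Berlekamp_Zassenhaus.Finite_Field"
begin

abbreviation X_poly :: "'a::comm_semiring_1 poly" where
  "X_poly \<equiv> [:0, 1:]"

(* The embedding of the prime field F_p = 'p mod_ring, p = CARD('p), into a field of
   characteristic p.  It is a ring homomorphism only if CHAR('a) = CARD('p). *)
definition prime_embed :: "'p::prime_card mod_ring \<Rightarrow> 'a::field" where
  "prime_embed x = of_int (to_int_mod_ring x)"

(* The polynomial g_{n,q} in F_p[X], where F_q is the field 'f (so q = CARD('f)) and
   F_p is 'p mod_ring; to be used with CARD('p) = CHAR('f).  The functional equation
   is an identity in F_q[X].  It determines g uniquely, because substitution of the
   nonconstant polynomial X^q - X is injective. *)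
definition g_poly :: "'f::{field,finite} itself \<Rightarrow> nat \<Rightarrow> 'p::prime_card mod_ring poly" where
  "g_poly _ n = (THE g.
     (\<Sum>c\<in>(UNIV :: 'f set). [:c, 1:] ^ n) =
     pcompose (map_poly prime_embed g) (X_poly ^ CARD('f) - X_poly))"

definition S_poly :: "nat \<Rightarrow> nat \<Rightarrow> 'a::comm_semiring_1 poly" where
  "S_poly q a = (\<Sum>i<a. X_poly ^ (q ^ i))"

definition permutation_poly :: "'k::{field,finite} poly \<Rightarrow> bool" where
  "permutation_poly f \<longleftrightarrow> bij (poly f)"

end

theory Submission
  imports Defs
begin

text \<open>
  \<^bold>\<open>The polynomial.\<close> Write $n = 1 + 2 \cdot 4 + 2 \cdot 4^{e-1} + 2 \cdot 4^{e+1}$.  In characteristic 2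
  the powers with exponent $4^i$ are additive, and $c^4 = c$ for \<open>c\<close> in the field with four
  elements, so
  $$(X + c)^n = (X + c)(A + c^2)(B + c^2)(D + c^2)$$
  with $A = X^{2 \cdot 4}$, $B = X^{2 \cdot 4^{e-1}}$ and $D = X^{2 \cdot 4^{e+1}}$.  Reduce this to degree at most 3
  in \<open>c\<close> by $c^4 = c$.  Summing over \<open>c\<close> kills the parts of degree 0, 1 and 2 and leaves the
  coefficient of $c^3$, which is $X + AB + AD + BD = X + A^2 + (A + B)(A + D)$.  Since
  $S_a(X^4 - X) = X^{4^a} - X$, the three terms $X + A^2$, $A + B$ and $A + D$ are the values at $X^4 - X$
  of $S_2$, of $(X + S_{e-1})^2$ and of $S_e^8$.  Substitution of $X^4 - X$ is injective, hence
  $g = S_2 + (X + S_{e-1})^2 S_e^8$ exactly (\<open>g_poly_eq_g_form\<close>).  The congruence follows because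
  $S_e^4 - S_e = X^{4^e} - X$ (\<open>g_form_cong\<close>).

  \<^bold>\<open>The permutation.\<close> On the field with $4^e$ elements $S_e$ is the trace \<open>T\<close> to the field with four
  elements.  Put $b(x) = x + S_{e-1}(x)$.  Then $g(x) = x + x^4 + (T(x) b(x))^2$, and for odd \<open>e\<close> both \<open>b\<close> and
  \<open>g\<close> preserve the trace.  So $g(x) = g(y)$ forces $T(x) = T(y) = t$, and with $d = x + y$ and
  $\beta = b(x) + b(y)$ the equations $b(x)^4 = x^4 + x + T(x)$ and $g(x) = g(y)$ give
  $\beta^4 = d^4 + d = (t \beta)^2$.  Hence \<open>\<beta>\<close> is 0 or \<open>t\<close>.  But \<open>\<beta>\<close> has trace 0 whereas \<open>t\<close> has trace
  \<open>t\<close>, so $\beta = 0$ in either case.  Now $d^4 = d$, so \<open>d\<close> equals its own trace, which is 0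
  (\<open>inj_g_form\<close>).
\<close>

section \<open>Frobenius sums\<close>

text \<open>
  The polynomial $S_a$ as an operation on any commutative semiring: $S_a$ itself, its values, its
  compositions and its images under homomorphisms are all instances of it, so that one identity
  serves for polynomials and for field elements.
\<close>
definition frob_sum :: "nat \<Rightarrow> nat \<Rightarrow> 'a::comm_semiring_1 \<Rightarrow> 'a" where
  "frob_sum q a x = (\<Sum>i<a. x ^ (q ^ i))"

lemma S_poly_eq_frob_sum: "S_poly q a = frob_sum q a X_poly"
  by (simp add: S_poly_def frob_sum_def)

lemma (in comm_ring_hom) hom_frob_sum: "hom (frob_sum q a x) = frob_sum q a (hom x)"
  by (simp add: frob_sum_def hom_distribs)

lemma frob_sum_Suc: "frob_sum q (Suc a) x = frob_sum q a x + x ^ (q ^ a)"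
  by (simp add: frob_sum_def)

text \<open>
  Both sides are the sum of $x^{q^i}$ for $i \le a$.  The terms that differ are moved across so that
  the identity holds without subtraction; with additivity it becomes $S_a(x^q - x) = x^{q^a} - x$.
\<close>
lemma frob_sum_power_shift: "frob_sum q a (x ^ q) + x = frob_sum q a x + x ^ (q ^ a)"
proof -
  have "frob_sum q a (x ^ q) + x = frob_sum q (Suc a) x"
    unfolding frob_sum_def by (subst sum.lessThan_Suc_shift) (simp add: add.commute flip: power_mult)
  thus ?thesis by (simp add: frob_sum_Suc)
qed

lemma frob_sum_add:
  fixes x y :: "'a::comm_semiring_1"
  assumes "prime CHAR('a)" "q = CHAR('a) ^ m"
  shows "frob_sum q a (x + y) = frob_sum q a x + frob_sum q a y"
  unfolding frob_sum_def sum.distrib [symmetric]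
  by (intro sum.cong refl freshmans_dream'[OF assms(1), where n = "m * _"])
     (simp add: assms(2) power_mult)

lemma frob_sum_power:
  fixes x :: "'a::comm_semiring_1"
  assumes "prime CHAR('a)" "r = CHAR('a) ^ m"
  shows "frob_sum q a (x ^ r) = frob_sum q a x ^ r"
  unfolding frob_sum_def freshmans_dream_sum'[OF assms]
  by (simp add: mult.commute flip: power_mult)

lemma frob_sum_power_minus_self:
  fixes x :: "'a::comm_ring_1"
  assumes "prime CHAR('a)" "q = CHAR('a) ^ m"
  shows "frob_sum q a (x ^ q - x) = x ^ (q ^ a) - x"
proof -
  have "frob_sum q a (x ^ q) = frob_sum q a (x ^ q - x) + frob_sum q a x"
    by (subst frob_sum_add[OF assms, symmetric]) simp
  thus ?thesis
    using frob_sum_power_shift[of q a x] by (simp add: algebra_simps)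
qed

text \<open>
  Linearity over the fixed field of the Frobenius map, as for a trace.
\<close>
lemma frob_sum_mult_fixed:
  assumes "c ^ q = c"
  shows "frob_sum q a (c * x) = c * frob_sum q a x"
proof -
  have "c ^ (q ^ i) = c" for i
    by (induction i) (simp_all add: power_mult assms)
  thus ?thesis
    by (simp add: frob_sum_def power_mult_distrib sum_distrib_left)
qed

lemma frob_sum_fixed:
  assumes "c ^ q = c"
  shows "frob_sum q a c = of_nat a * c"
  using frob_sum_mult_fixed[OF assms, of a 1] by (simp add: frob_sum_def mult.commute)

section \<open>Power sums over a finite field\<close>

text \<open>
  Multiplication by \<open>x\<close> permutes the nonzero elements, so it does not change their product.
\<close>
lemma power_card_minus_1_eq_1:
  fixes x :: "'a::{field,finite}"
  assumes "x \<noteq> 0"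
  shows "x ^ (CARD('a) - 1) = 1"
proof -
  have "\<Prod>(UNIV - {0}) = (\<Prod>y\<in>UNIV - {0}. x * y)"
    by (rule prod.reindex_bij_witness[of _ "\<lambda>y. x * y" "\<lambda>y. y / x"]) (use assms in auto)
  also have "\<dots> = x ^ (CARD('a) - 1) * \<Prod>(UNIV - {0})"
    by (simp add: prod.distrib card_Diff_singleton)
  finally show ?thesis by simp
qed

lemma power_card_eq_self:
  fixes x :: "'a::{field,finite}"
  shows "x ^ CARD('a) = x"
proof (cases "x = 0")
  case False
  thus ?thesis
    using power_card_minus_1_eq_1[OF False] power_minus_mult[of "CARD('a)" x] by simp
qed simp

text \<open>
  Replacing \<open>c\<close> by \<open>b * c\<close> permutes the field and multiplies the sum by $b^k \neq 1$.
\<close>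
lemma sum_powers_eq_0:
  fixes b :: "'a::{field,finite}"
  assumes "b \<noteq> 0" "b ^ k \<noteq> 1"
  shows "(\<Sum>c\<in>(UNIV::'a set). c ^ k) = 0"
proof -
  have "(\<Sum>c\<in>(UNIV::'a set). c ^ k) = (\<Sum>c\<in>UNIV. (b * c) ^ k)"
    by (rule sum.reindex_bij_witness[of _ "\<lambda>c. b * c" "\<lambda>c. c / b"]) (use assms in auto)
  also have "\<dots> = b ^ k * (\<Sum>c\<in>UNIV. c ^ k)"
    by (simp add: power_mult_distrib sum_distrib_left)
  finally have "(b ^ k - 1) * (\<Sum>c\<in>(UNIV::'a set). c ^ k) = 0"
    by (simp add: algebra_simps)
  thus ?thesis using assms by simp
qed

lemma CHAR_eq_prime_of_card:
  assumes "CARD('a::{field,finite}) = r ^ m" "prime r"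
  shows "CHAR('a) = r"
proof -
  have "prime CHAR('a)"
    by (rule prime_CHAR_semidom) (simp add: finite_imp_CHAR_pos)
  moreover have "CHAR('a) dvd r ^ m"
    using CHAR_dvd_CARD[where 'a = 'a] assms(1) by simp
  ultimately show ?thesis
    using assms(2) prime_dvd_power primes_dvd_imp_eq by blast
qed

lemma sum_powers_card_4:
  assumes "CARD('f::{field,finite}) = 4"
  shows "(\<Sum>c\<in>(UNIV::'f set). c) = 0"
    and "(\<Sum>c\<in>(UNIV::'f set). c ^ 2) = 0"
    and "(\<Sum>c\<in>(UNIV::'f set). c ^ 3) = 1"
proof -
  have ch: "CHAR('f) = 2"
    using CHAR_eq_prime_of_card[where 'a = 'f and r = 2 and m = 2] assms by simp
  have "card {0, 1::'f} < CARD('f)"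
    by (simp add: assms)
  hence "\<exists>b::'f. b \<notin> {0, 1}"
    by (metis UNIV_eq_I less_irrefl)
  then obtain b :: 'f where b: "b \<noteq> 0" "b \<noteq> 1" by auto
  \<comment> \<open>In characteristic 2 the only square root of 1 is 1, so \<open>b\<close> serves for both exponents.\<close>
  show "(\<Sum>c\<in>(UNIV::'f set). c) = 0"
    using sum_powers_eq_0[of b 1] b by simp
  have "b ^ 2 \<noteq> 1"
    using b by (simp add: power2_eq_1_iff uminus_CHAR_2[OF ch])
  thus "(\<Sum>c\<in>(UNIV::'f set). c ^ 2) = 0"
    using sum_powers_eq_0[of b 2] b by simp
  have "(\<Sum>c\<in>(UNIV::'f set). c ^ 3) = (\<Sum>c\<in>UNIV - {0::'f}. c ^ 3)"
    by (rule sum.mono_neutral_right) auto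
  also have "\<dots> = (\<Sum>c\<in>UNIV - {0::'f}. 1)"
    by (rule sum.cong) (use power_card_minus_1_eq_1[where 'a = 'f] assms in auto)
  also have "\<dots> = of_nat 3"
    by (simp add: assms card_Diff_singleton)
  also have "\<dots> = (of_nat 1 :: 'f)"
    by (subst of_nat_eq_iff_cong_CHAR) (simp add: ch cong_def)
  finally show "(\<Sum>c\<in>(UNIV::'f set). c ^ 3) = 1" by simp
qed

section \<open>The functional equation in characteristic 2\<close>

text \<open>
  The closed form of \<open>g\<close> before reduction modulo $X^{4^e} - X$.  The exponent 8 becomes 2 under that
  reduction.
\<close>
definition g_form :: "nat \<Rightarrow> 'a::comm_semiring_1 \<Rightarrow> 'a" where
  "g_form e x = frob_sum 4 2 x + (x + frob_sum 4 (e - 1) x) ^ 2 * frob_sum 4 e x ^ 8"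

lemma (in comm_ring_hom) hom_g_form: "hom (g_form e x) = g_form e (hom x)"
  by (simp add: g_form_def hom_distribs hom_frob_sum)

lemma char_2_powers:
  assumes "CHAR('a::semiring_1) = 2"
  shows "prime CHAR('a)" "4 = CHAR('a) ^ 2" "2 = CHAR('a) ^ 1"
  by (simp_all add: assms)

lemma char_2_simps:
  fixes x y :: "'a::comm_ring_1"
  assumes "CHAR('a) = 2"
  shows "x - y = x + y" "x + x = 0" "x + (x + y) = y" "x + y = 0 \<longleftrightarrow> x = y"
proof -
  show "x - y = x + y"
    by (rule minus_CHAR_2[OF assms])
  show "x + x = 0"
    using minus_CHAR_2[OF assms, of x x] by simp
  thus "x + (x + y) = y"
    by (simp flip: add.assoc)
  show "x + y = 0 \<longleftrightarrow> x = y"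
    using right_minus_eq[of x y] unfolding minus_CHAR_2[OF assms] .
qed

lemma char_2_dream:
  fixes x y :: "'a::comm_ring_1"
  assumes "CHAR('a) = 2"
  shows "(x + y) ^ 2 = x ^ 2 + y ^ 2" "(x + y) ^ 4 = x ^ 4 + y ^ 4"
  using freshmans_dream'[OF char_2_powers(1,3), of x y] freshmans_dream'[OF char_2_powers(1,2), of x y]
  by (simp_all add: assms)

text \<open>
  Each factor telescopes.  With \<open>A\<close>, \<open>B\<close>, \<open>D\<close> as below, the left-hand side is
  $(x + A^2) + (A + B)(A + D)$, in which $A^2$ cancels.
\<close>
lemma g_form_of_power_minus_self:
  fixes x :: "'a::comm_ring_1"
  assumes ch: "CHAR('a) = 2"
    and "A = (x ^ 4) ^ 2" "B = (x ^ (4 ^ (e - 1))) ^ 2" "D = (x ^ (4 ^ (e + 1))) ^ 2"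
  shows "g_form e (x ^ 4 - x) = x + A * B + A * D + B * D"
proof -
  note pows = char_2_powers[OF ch]
  note simps2 = char_2_simps[OF ch]
  note dream2 = char_2_dream[OF ch]
  note S = frob_sum_power_minus_self[OF pows(1,2)]
  have "(x ^ 4 - x + frob_sum 4 (e - 1) (x ^ 4 - x)) ^ 2 = A + B"
    unfolding S by (simp add: simps2 dream2(1) add_ac assms)
  moreover have "frob_sum 4 e (x ^ 4 - x) ^ 8 = A + D"
  proof -
    have "frob_sum 4 e (x ^ 4 - x) ^ 8 = ((x ^ (4 ^ e) + x) ^ 4) ^ 2"
      unfolding S by (simp add: simps2(1) flip: power_mult)
    also have "\<dots> = A + D"
      by (simp add: dream2 assms mult.commute add.commute flip: power_mult)
    finally show ?thesis .
  qed
  moreover have "frob_sum 4 2 (x ^ 4 - x) = x + A * A"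
    unfolding S by (simp add: simps2(1) assms add.commute flip: power_mult power_add)
  ultimately show ?thesis
    unfolding g_form_def by (simp add: algebra_simps simps2(2,3))
qed

text \<open>
  The coefficients of $C^4$, $C^5$, $C^6$ and $C^7$ are folded onto those of $C$, $C^2$, $C^3$ and $C$; in
  particular the coefficient of $C^3$ picks up the \<open>x\<close> of $x C^6$.
\<close>
lemma expand_product_mod_power_4:
  fixes x A B D C :: "'a::comm_ring_1"
  assumes "C ^ 4 = C"
  shows "(x + C) * (A + C ^ 2) * (B + C ^ 2) * (D + C ^ 2) =
     x * A * B * D + (A * B * D + x * (A + B + D) + 1) * C
     + (x * (A * B + A * D + B * D) + (A + B + D)) * C ^ 2 + (x + A * B + A * D + B * D) * C ^ 3"
proof -
  have "(x + C) * (A + C ^ 2) * (B + C ^ 2) * (D + C ^ 2) =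
     x * A * B * D + A * B * D * C + x * (A * B + A * D + B * D) * C ^ 2
     + (A * B + A * D + B * D) * C ^ 3 + x * (A + B + D) * C ^ 4 + (A + B + D) * (C ^ 4 * C)
     + x * (C ^ 4 * C ^ 2) + C ^ 4 * C ^ 3"
    by (simp add: power2_eq_square power3_eq_cube power4_eq_xxxx distrib_left distrib_right mult_ac add_ac)
  also have "C ^ 4 * C ^ 3 = C"
    using assms by (simp add: power3_eq_cube power4_eq_xxxx mult.assoc)
  finally show ?thesis
    by (simp add: assms power2_eq_square power3_eq_cube algebra_simps)
qed

lemma sum_const_poly: "(\<Sum>c\<in>M. [:f c:]) = [:\<Sum>c\<in>M. f c:]"
  by (induction M rule: infinite_finite_induct) simp_all

lemma sum_powers_linear_poly_card_4:
  assumes card: "CARD('f::{field,finite}) = 4"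
  shows "(\<Sum>c\<in>(UNIV::'f set). [:c, 1:] ^ (1 + 2 * 4 ^ 1 + 2 * 4 ^ (e - 1) + 2 * 4 ^ (e + 1)))
    = g_form e (X_poly ^ 4 - X_poly)"
proof -
  have chf: "CHAR('f) = 2"
    using CHAR_eq_prime_of_card[where 'a = 'f and r = 2 and m = 2] card by simp
  have ch: "CHAR('f poly) = 2"
    by (simp add: chf)
  note pows = char_2_powers[OF ch]
  note simps2 = char_2_simps[OF ch]
  note dream2 = char_2_dream[OF ch]
  define x :: "'f poly" where "x = X_poly"
  define A where "A = (x ^ 4) ^ 2"
  define B where "B = (x ^ (4 ^ (e - 1))) ^ 2"
  define D where "D = (x ^ (4 ^ (e + 1))) ^ 2"
  have fixed: "[:c:] ^ (4 ^ i) = [:c:]" for c :: 'f and i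
    by (induction i) (simp_all add: power_mult poly_const_pow power_card_eq_self[of c, unfolded card])
  have dream: "[:c, 1:] ^ (2 * 4 ^ i) = (x ^ (4 ^ i)) ^ 2 + [:c:] ^ 2" for c i
  proof -
    have "[:c, 1:] ^ (2 * 4 ^ i) = ((x + [:c:]) ^ (4 ^ i)) ^ 2"
      by (simp add: x_def mult.commute flip: power_mult)
    also have "(x + [:c:]) ^ (4 ^ i) = x ^ (4 ^ i) + [:c:] ^ (4 ^ i)"
      by (rule freshmans_dream'[OF pows(1), where n = "2 * i"]) (simp only: pows(2) power_mult)
    finally show ?thesis by (simp add: dream2(1) fixed)
  qed
  have summand: "[:c, 1:] ^ (1 + 2 * 4 ^ 1 + 2 * 4 ^ (e - 1) + 2 * 4 ^ (e + 1)) =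
     x * A * B * D + (A * B * D + x * (A + B + D) + 1) * [:c:]
     + (x * (A * B + A * D + B * D) + (A + B + D)) * [:c ^ 2:]
     + (x + A * B + A * D + B * D) * [:c ^ 3:]" for c
  proof -
    have "[:c, 1:] ^ (1 + 2 * 4 ^ 1 + 2 * 4 ^ (e - 1) + 2 * 4 ^ (e + 1)) =
        (x + [:c:]) * (A + [:c:] ^ 2) * (B + [:c:] ^ 2) * (D + [:c:] ^ 2)"
      unfolding power_add[of "[:c, 1:]"] dream A_def B_def D_def by (simp add: x_def)
    also have "\<dots> = x * A * B * D + (A * B * D + x * (A + B + D) + 1) * [:c:]
     + (x * (A * B + A * D + B * D) + (A + B + D)) * [:c:] ^ 2
     + (x + A * B + A * D + B * D) * [:c:] ^ 3"
      by (rule expand_product_mod_power_4) (use fixed[of c 1] in simp)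
    finally show ?thesis by (simp only: poly_const_pow)
  qed
  have zero: "of_nat CARD('f) = (0 :: 'f poly)"
    by (subst of_nat_eq_0_iff_char_dvd) (simp add: chf card)
  have "(\<Sum>c\<in>(UNIV::'f set). [:c, 1:] ^ (1 + 2 * 4 ^ 1 + 2 * 4 ^ (e - 1) + 2 * 4 ^ (e + 1)))
    = x + A * B + A * D + B * D"
    unfolding summand sum.distrib sum_distrib_left [symmetric] sum_const_poly sum_powers_card_4[OF card] sum_constant zero
    by (simp flip: one_pCons)
  also have "\<dots> = g_form e (x ^ 4 - x)"
    by (rule g_form_of_power_minus_self[OF ch A_def B_def D_def, symmetric])
  finally show ?thesis unfolding x_def .
qed

section \<open>The embedding of the prime field\<close>

text \<open>
  Lifting residues to integers respects sums and products only modulo \<open>p\<close>; equality of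
  characteristics makes the image insensitive to that.  Injectivity holds because no integer
  strictly between 0 and \<open>p\<close> is divisible by the characteristic.
\<close>
lemma inj_comm_ring_hom_prime_embed:
  assumes "CHAR('a::field) = CARD('p::prime_card)"
  shows "inj_comm_ring_hom (prime_embed :: 'p mod_ring \<Rightarrow> 'a)"
proof
  have mod: "(of_int (i mod int CARD('p)) :: 'a) = of_int i" for i
    by (simp add: of_int_eq_iff_cong_CHAR assms cong_def)
  fix x y :: "'p mod_ring"
  show "prime_embed (x + y) = (prime_embed x + prime_embed y :: 'a)"
    by (simp add: prime_embed_def to_int_mod_ring_add mod)
  show "prime_embed (x * y) = (prime_embed x * prime_embed y :: 'a)"
    by (simp add: prime_embed_def to_int_mod_ring_mult mod)
  show "prime_embed 0 = (0::'a)" "prime_embed (1 :: 'p mod_ring) = (1::'a)"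
    by (simp_all add: prime_embed_def)
  show "x = 0" if "prime_embed x = (0 :: 'a)"
  proof -
    have "int CHAR('a) dvd to_int_mod_ring x"
      using that by (simp add: prime_embed_def of_int_eq_0_iff_char_dvd)
    moreover have "0 \<le> to_int_mod_ring x" "to_int_mod_ring x < int CHAR('a)"
      using range_to_int_mod_ring[where 'a = 'p] assms by auto
    ultimately have "to_int_mod_ring x = 0"
      using zdvd_not_zless[of "to_int_mod_ring x" "int CHAR('a)"] by linarith
    thus ?thesis by simp
  qed
qed

text \<open>
  Turns the definite description into a criterion: substituting a nonconstant polynomial and
  extending coefficients along an injective homomorphism are both injective, so any solution of
  the functional equation is the polynomial meant.
\<close>
lemma g_poly_unique:
  fixes h :: "'p::prime_card mod_ring poly"
  assumes "CARD('p) = CHAR('f::{field,finite})"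
    and "(\<Sum>c\<in>(UNIV :: 'f set). [:c, 1:] ^ n) =
      pcompose (map_poly prime_embed h) (X_poly ^ CARD('f) - X_poly)"
  shows "g_poly TYPE('f) n = h"
  unfolding g_poly_def
proof (rule the_equality)
  fix k :: "'p mod_ring poly"
  interpret inj_comm_ring_hom "prime_embed :: 'p mod_ring \<Rightarrow> 'f"
    using inj_comm_ring_hom_prime_embed assms(1) by metis
  interpret map_poly_inj_comm_ring_hom "prime_embed :: 'p mod_ring \<Rightarrow> 'f" ..
  define r :: "'f poly" where "r = X_poly ^ CARD('f) - X_poly"
  have "1 < CARD('f)"
    using card_mono[of "UNIV :: 'f set" "{0, 1}"] by simp
  hence "Polynomial.coeff r CARD('f) = 1"
    by (simp add: r_def x_as_monom monom_power)
  hence deg: "Polynomial.degree r > 0"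
    using \<open>1 < CARD('f)\<close> le_degree[of r "CARD('f)"] by simp
  assume "(\<Sum>c\<in>(UNIV :: 'f set). [:c, 1:] ^ n) =
      pcompose (map_poly prime_embed k) (X_poly ^ CARD('f) - X_poly)"
  hence "pcompose (map_poly prime_embed k - map_poly prime_embed h) r = 0"
    using assms(2) by (simp add: r_def pcompose_diff)
  hence "map_poly prime_embed k - map_poly prime_embed h = (0 :: 'f poly)"
    by (rule pcompose_eq_0[OF _ deg])
  thus "k = h" by simp
qed (rule assms(2))

lemma map_poly_g_form:
  assumes "CARD('p::prime_card) = CHAR('a::field)"
  shows "map_poly prime_embed (g_form e (X_poly :: 'p mod_ring poly)) = (g_form e X_poly :: 'a poly)"
proof -
  interpret inj_comm_ring_hom "prime_embed :: 'p mod_ring \<Rightarrow> 'a"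
    using inj_comm_ring_hom_prime_embed assms(1) by metis
  interpret m: map_poly_comm_ring_hom "prime_embed :: 'p mod_ring \<Rightarrow> 'a" ..
  show ?thesis by (simp add: m.hom_g_form hom_distribs)
qed

lemma g_poly_eq_g_form:
  assumes "CARD('f::{field,finite}) = 4" "CARD('p::prime_card) = CHAR('f)"
  shows "g_poly TYPE('f) (1 + 2 * 4 ^ 1 + 2 * 4 ^ (e - 1) + 2 * 4 ^ (e + 1))
    = (g_form e X_poly :: 'p mod_ring poly)"
  by (rule g_poly_unique[OF assms(2)])
     (simp only: sum_powers_linear_poly_card_4[OF assms(1)] map_poly_g_form[OF assms(2)]
        pcompose_hom.hom_g_form assms(1), simp)

section \<open>Reduction modulo the field equation\<close>

text \<open>
  $S_e(x)^4 - S_e(x) = x^{4^e} - x$, so $S_e(x)$ is a fixed point of the Frobenius map modulo that element.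
\<close>
lemma g_form_cong:
  fixes x :: "'a::{unique_euclidean_ring}"
  assumes ch: "CHAR('a) = 2"
  shows "[g_form e x = frob_sum 4 2 x + x\<^sup>2 * (frob_sum 4 e x)\<^sup>2
    + (frob_sum 4 (e - 1) x)\<^sup>2 * (frob_sum 4 e x)\<^sup>2] (mod (x ^ (4 ^ e) - x))"
proof -
  note pows = char_2_powers[OF ch]
  note simps2 = char_2_simps[OF ch]
  note dream2 = char_2_dream[OF ch]
  have "frob_sum 4 e x ^ 4 - frob_sum 4 e x = x ^ (4 ^ e) - x"
    using frob_sum_power_shift[of 4 e x] frob_sum_power[OF pows(1,2), of 4 e x]
    by (simp add: algebra_simps)
  hence "[frob_sum 4 e x ^ 4 = frob_sum 4 e x] (mod (x ^ (4 ^ e) - x))"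
    by (simp add: cong_iff_dvd_diff)
  from cong_pow[OF this, of 2]
  have "[frob_sum 4 e x ^ 8 = (frob_sum 4 e x)\<^sup>2] (mod (x ^ (4 ^ e) - x))"
    by (simp flip: power_mult)
  hence "[g_form e x = frob_sum 4 2 x + (x + frob_sum 4 (e - 1) x) ^ 2 * (frob_sum 4 e x)\<^sup>2]
      (mod (x ^ (4 ^ e) - x))"
    unfolding g_form_def by (intro cong_add cong_mult cong_refl)
  thus ?thesis by (simp add: dream2(1) algebra_simps)
qed

section \<open>Bijectivity by a trace argument\<close>

text \<open>
  Here \<open>T\<close> is the trace to the field with four elements.  It acts on that field as multiplication
  by \<open>e\<close>, that is, as the identity when \<open>e\<close> is odd; this is how the parity enters.
\<close>
lemma inj_g_form:
  assumes card: "CARD('k::{field,finite}) = 4 ^ e" and "odd e"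
  shows "inj (g_form e :: 'k \<Rightarrow> 'k)"
proof (rule injI)
  have ch: "CHAR('k) = 2"
    by (rule CHAR_eq_prime_of_card[where m = "2 * e"]) (simp_all add: card power_mult)
  note pows = char_2_powers[OF ch]
  note simps2 = char_2_simps[OF ch]
  note dream2 = char_2_dream[OF ch]
  define T :: "'k \<Rightarrow> 'k" where "T = frob_sum 4 e"
  define b :: "'k \<Rightarrow> 'k" where "b = (\<lambda>x. x + frob_sum 4 (e - 1) x)"
  have e: "Suc (e - 1) = e"
    using \<open>odd e\<close> by (cases e) auto
  have frob: "x ^ (4 ^ e) = x" for x :: 'k
    using power_card_eq_self[of x] by (simp add: card)
  have T_pow4: "T (x ^ 4) = T x" for x
    using frob_sum_power_shift[of 4 e x] by (simp add: frob T_def)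
  have T_4: "T x ^ 4 = T x" for x
    using T_pow4 frob_sum_power[OF pows(1,2), of 4 e x] by (simp add: T_def)
  have of_nat_e: "of_nat e = (1::'k)"
    using \<open>odd e\<close> of_nat_eq_iff_cong_CHAR[where 'a = 'k, of e 1] by (simp add: ch cong_def odd_iff_mod_2_eq_one)
  have T_fixed: "T c = c" if "c ^ 4 = c" for c
    using frob_sum_fixed[OF that, of e] by (simp add: T_def of_nat_e)
  have b_alt: "b x = x + T x + x ^ (4 ^ (e - 1))" for x
    using frob_sum_Suc[of 4 "e - 1" x] unfolding b_def T_def e by (simp add: simps2 add_ac)
  have T_add: "T (x + y) = T x + T y" for x y
    unfolding T_def by (rule frob_sum_add[OF pows(1,2)])
  have T_frob: "T (x ^ (4 ^ i)) = T x" for x i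
  proof (induction i)
    case (Suc i)
    have "x ^ (4 ^ Suc i) = (x ^ (4 ^ i)) ^ 4"
      by (simp add: mult.commute flip: power_mult)
    thus ?case using Suc by (simp add: T_pow4)
  qed simp
  \<comment> \<open>\<open>T (b x)\<close> is the sum of \<open>T x\<close>, \<open>T (T x) = T x\<close> and the trace \<open>T x\<close> of a conjugate of \<open>x\<close>.\<close>
  have T_b: "T (b x) = T x" for x
    by (simp add: b_alt T_add T_frob T_fixed[OF T_4] simps2 add_ac)
  have b_4: "b x ^ 4 = x ^ 4 + x + T x" for x
  proof -
    have "(x ^ (4 ^ (e - 1))) ^ 4 = x ^ 4 ^ e"
      using power_Suc[of "4::nat" "e - 1"] unfolding e by (simp add: mult.commute flip: power_mult)
    thus ?thesis by (simp add: b_alt dream2(2) T_4 frob add_ac)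
  qed
  have g_alt: "g_form e x = x + x ^ 4 + (T x * b x) ^ 2" for x
  proof -
    have "T x ^ 8 = (T x) ^ 2"
      using T_4[of x] by (metis mult_2 numeral_Bit0 power_mult power_mult_numeral num_double)
    thus ?thesis
      by (simp add: g_form_def T_def b_def frob_sum_def numeral_2_eq_2 power_mult_distrib mult.commute)
  qed
  have T_square: "T (x ^ 2) = T x ^ 2" for x
    unfolding T_def by (rule frob_sum_power[OF pows(1,3)])
  have T_g: "T (g_form e x) = T x" for x
  proof -
    have "T (T x * b x) = T x * T x"
      using frob_sum_mult_fixed[OF T_4[of x], of e "b x"] T_b by (simp add: T_def)
    hence "T (g_form e x) = (T x * T x) ^ 2"
      by (simp add: g_alt T_add T_pow4 T_square simps2)
    also have "\<dots> = T x" using T_4[of x] by (simp add: power2_eq_square power4_eq_xxxx mult_ac)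
    finally show ?thesis .
  qed
  fix x y :: 'k
  assume eq: "g_form e x = g_form e y"
  define t where "t = T x"
  have t: "T x = t" "T y = t"
    using T_g[of x] T_g[of y] eq by (simp_all add: t_def)
  have t4: "t ^ 4 = t" using T_4 t by metis
  define d where "d = x + y"
  define \<beta> where "\<beta> = b x + b y"
  have "\<beta> ^ 4 = d ^ 4 + d"
    unfolding \<beta>_def d_def dream2 b_4 t by (simp add: simps2(2-4) add_ac)
  also have "\<dots> = (t * \<beta>) ^ 2 + (g_form e x + g_form e y)"
    unfolding \<beta>_def d_def g_alt dream2 t power_mult_distrib by (simp add: simps2(2-4) algebra_simps)
  also have "\<dots> = (t * \<beta>) ^ 2"
    by (simp add: eq simps2)
  finally have "(\<beta> ^ 2 + t * \<beta>) ^ 2 = 0"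
    by (simp add: simps2(2) dream2(1) flip: power_mult)
  hence "\<beta> ^ 2 + t * \<beta> = 0"
    by (simp only: power_eq_0_iff)
  hence "\<beta> * (\<beta> + t) = 0"
    by (simp add: power2_eq_square algebra_simps)
  hence "\<beta> = 0 \<or> \<beta> = t"
    using simps2(4)[of \<beta> t] by auto
  moreover have "T \<beta> = 0"
    by (simp add: \<beta>_def T_add T_b t simps2)
  ultimately have "\<beta> = 0"
    using T_fixed[OF t4] by auto
  hence "d ^ 4 + d = 0"
    using \<open>\<beta> ^ 4 = d ^ 4 + d\<close> by simp
  hence "d ^ 4 = d"
    using simps2(4)[of "d ^ 4" d] by auto
  hence "d = T d"
    by (simp add: T_fixed)
  also have "T d = 0"
    by (simp add: d_def T_add t simps2)
  finally show "x = y"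
    using simps2(4)[of x y] by (simp add: d_def)
qed

theorem proposition3p5:
  fixes q n e :: nat
    and g :: "'p::prime_card mod_ring poly"
  assumes "q = 4"
    and "CARD('f::{field,finite}) = q"
    and "CARD('p) = CHAR('f)"
    and "CARD('k::{field,finite}) = q ^ e"
    and "e > 1"
    and "n = 1 + 2 * q ^ 1 + 2 * q ^ (e - 1) + 2 * q ^ (e + 1)"
    and "g = g_poly TYPE('f) n"
  shows "[g = S_poly q 2 + X_poly\<^sup>2 * (S_poly q e)\<^sup>2 + (S_poly q (e - 1))\<^sup>2 * (S_poly q e)\<^sup>2]
           (mod (X_poly ^ (q ^ e) - X_poly))
       \<and> (odd e \<longrightarrow> permutation_poly (map_poly prime_embed g :: 'k poly))"
proof -
  have chf: "CHAR('f) = 2"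
    by (rule CHAR_eq_prime_of_card[where m = 2]) (simp_all add: assms)
  have chk: "CHAR('k) = 2"
    by (rule CHAR_eq_prime_of_card[where m = "2 * e"]) (simp_all add: assms power_mult)
  have g: "g = g_form e X_poly"
    using g_poly_eq_g_form[where 'f = 'f and 'p = 'p] assms by simp
  have chp: "CHAR('p mod_ring poly) = 2"
    using assms(3) chf CHAR_eq_prime_of_card[where 'a = "'p mod_ring" and r = 2 and m = 1] by simp
  have "permutation_poly (map_poly prime_embed g :: 'k poly)" if "odd e"
  proof -
    have "poly (map_poly prime_embed g :: 'k poly) = g_form e"
      using assms(3) chf chk by (simp add: fun_eq_iff g map_poly_g_form poly_hom.hom_g_form)
    moreover have "inj (g_form e :: 'k \<Rightarrow> 'k)"
      using assms that by (intro inj_g_form) simp_all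
    ultimately show ?thesis
      by (simp add: permutation_poly_def bij_def finite_UNIV_inj_surj)
  qed
  thus ?thesis
    using g_form_cong[OF chp, of e X_poly] assms(1) by (simp add: g S_poly_eq_frob_sum)
qed

end
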